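(* Let $(X,\mathsf a)$ be an action space and let $u:[a,b]\to X$ be $\mathsf a$-absolutely continuous. Then for almost every $t\in(a,b)$ the two limits $$\lim_{\sigma\downarrow t}\frac{\mathsf a(\sigma-t,u(t),u(\sigma))}{\sigma-t}=\lim_{\sigma\uparrow t}\frac{\mathsf a(t-\sigma,u(\sigma),u(t))}{t-\sigma}=:\mathfrak a[u'](t)$$ exist and coincide, and $$\mathsf a(t-s,u(s),u(t))\le\int_s^t\mathfrak a[u'](r)\,\mathrm dr\qquad\text{for all }a\le s<t\le b,$$ $$\mathfrak a[u'](t)\le g(t)\qquad\text{for a.e. }t\in(a,b)$$ for every $g\in L^1(a,b)$ such that $\mathsf a(t-s,u(s),u(t))\le\int_s^tg(r)\,\mathrm dr$ for all $a\le s<t\le b$. Therefore, $\mathfrak a[u']\in L^1(a,b)$.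
   Context: An action cost on a set $X$ is a function $\mathsf a:(0,+\infty)\times X\times X\to[0,+\infty)$ such that for all $\tau,\tau_1,\tau_2>0$ and $u_1,u_2,u_3\in X$: (i) $\mathsf a(\tau,u_1,u_2)=0$ if and only if $u_1=u_2$; (ii) $\mathsf a(\tau,u_1,u_2)=\mathsf a(\tau,u_2,u_1)$; (iii) $\mathsf a(\tau_1+\tau_2,u_1,u_3)\le \mathsf a(\tau_1,u_1,u_2)+\mathsf a(\tau_2,u_2,u_3)$. The pair $(X,\mathsf a)$ is called an action space. A curve $u:[a,b]\to X$ is $\mathsf a$-absolutely continuous, written $u\in\mathrm{AC}_{\mathsf a}([a,b];X)$, if there exists $g\in L^1(a,b)$ such that $\mathsf a(t-s,u(s),u(t))\le\int_s^tg(r)\,\mathrm dr$ for all $a\le s<t\le b$. The function $\mathfrak a[u']$ is called the action density of $u$. *)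

theory Defs
  imports "HOL-Analysis.Analysis"
begin

(* Only the values of cost at positive times and at points of X are meaningful. *)
locale action_space =
  fixes X :: "'a set" and cost :: "real \<Rightarrow> 'a \<Rightarrow> 'a \<Rightarrow> real"
  assumes cost_nonneg: "\<lbrakk>\<tau> > 0; x \<in> X; y \<in> X\<rbrakk> \<Longrightarrow> cost \<tau> x y \<ge> 0"
    and cost_eq_0_iff: "\<lbrakk>\<tau> > 0; x \<in> X; y \<in> X\<rbrakk> \<Longrightarrow> cost \<tau> x y = 0 \<longleftrightarrow> x = y"
    and cost_sym: "\<lbrakk>\<tau> > 0; x \<in> X; y \<in> X\<rbrakk> \<Longrightarrow> cost \<tau> x y = cost \<tau> y x"
    and cost_concat:
      "\<lbrakk>\<tau>\<^sub>1 > 0; \<tau>\<^sub>2 > 0; x \<in> X; y \<in> X; z \<in> X\<rbrakk>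
        \<Longrightarrow> cost (\<tau>\<^sub>1 + \<tau>\<^sub>2) x z \<le> cost \<tau>\<^sub>1 x y + cost \<tau>\<^sub>2 y z"

(* Integrability is with respect to the complete Lebesgue measure; integrating over the open
   interval between s and t consults g only on the open interval between a and b. *)
definition action_majorant ::
    "(real \<Rightarrow> 'a \<Rightarrow> 'a \<Rightarrow> real) \<Rightarrow> real \<Rightarrow> real \<Rightarrow> (real \<Rightarrow> 'a) \<Rightarrow> (real \<Rightarrow> real) \<Rightarrow> bool" where
  "action_majorant cost a b u g \<longleftrightarrow>
     set_integrable lebesgue {a<..<b} g \<and>
     (\<forall>s t. a \<le> s \<and> s < t \<and> t \<le> b \<longrightarrow>
        cost (t - s) (u s) (u t) \<le> (LINT r:{s<..<t}|lebesgue. g r))"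

definition action_abs_cont ::
    "'a set \<Rightarrow> (real \<Rightarrow> 'a \<Rightarrow> 'a \<Rightarrow> real) \<Rightarrow> real \<Rightarrow> real \<Rightarrow> (real \<Rightarrow> 'a) \<Rightarrow> bool" where
  "action_abs_cont X cost a b u \<longleftrightarrow>
     u \<in> {a..b} \<rightarrow> X \<and> (\<exists>g. action_majorant cost a b u g)"

(* The limit from the right; where this limit does not exist the value is arbitrary. *)
definition action_density ::
    "(real \<Rightarrow> 'a \<Rightarrow> 'a \<Rightarrow> real) \<Rightarrow> (real \<Rightarrow> 'a) \<Rightarrow> real \<Rightarrow> real" where
  "action_density cost u t =
     Lim (at_right t) (\<lambda>\<sigma>. cost (\<sigma> - t) (u t) (u \<sigma>) / (\<sigma> - t))"

end

theory Submission
  imports Defs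
begin

text \<open>
  Along the curve, the cost is a function \<open>A s t = cost (t - s) (u s) (u t)\<close> of the interval
  \<open>[s, t]\<close>. It is nonnegative and subadditive, and absolute continuity bounds it by an integral. As
  the cost depends on the elapsed time it is not a metric, and the usual argument through the
  functions \<open>t \<mapsto> d(u(t), x)\<close> for a dense set of points \<open>x\<close> has no counterpart. The proof compares
  \<open>A\<close> with the smallest additive function of intervals above it.

  This function is the variation \<open>V\<close>, the supremum of the sums of \<open>A\<close> over partitions. It is
  additive and bounded by the same integral, so its Stieltjes measure is absolutely continuous and
  \<open>V s t\<close> is the integral of a density \<open>m\<close> over \<open>[s, t]\<close> (\<open>dominated_increments_eq_integral\<close>). By
  Lebesgue differentiation the averages of \<open>m\<close> over small intervals at \<open>x\<close> tend to \<open>m x\<close> for almost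
  every \<open>x\<close>.

  The point is that \<open>A\<close> and \<open>V\<close> have the same derivative almost everywhere. The defect \<open>D = V - A\<close>
  is nonnegative and superadditive. Given \<open>\<eta> > 0\<close>, choose a partition whose sum is within \<open>\<eta>\<close> of
  \<open>V a b\<close>. Disjoint intervals that do not cross a partition point then have total defect at most \<open>\<eta>\<close>,
  by superadditivity (\<open>partition_sum_control\<close>). If \<open>D\<close> exceeds \<open>\<epsilon>\<close> times the length on arbitrarily
  short intervals around each point of a set \<open>E\<close>, Vitali's covering theorem yields disjoint intervals
  of this kind that cover almost all of \<open>E\<close>, and \<open>E\<close> has outer measure at most \<open>\<eta> / \<epsilon>\<close>
  (\<open>interval_quotient_tendsto_0_AE\<close>). As \<open>\<eta>\<close> is arbitrary, \<open>E\<close> is negligible.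

  Hence both one-sided limits exist almost everywhere and equal \<open>m\<close> (\<open>density_exists\<close>). The
  integral inequality is \<open>A \<le> V\<close>, and the minimality of the density follows by differentiating the
  inequality that defines a majorant.
\<close>

section \<open>Interval functions with small sums over disjoint families\<close>

text \<open>The interval with the largest right endpoint is removed first: disjointness forces all
  the others to end before it begins, so the induction continues with its left endpoint in place of
  \<open>b\<close>.\<close>

lemma sum_increments_le:
  fixes F :: "real \<Rightarrow> real"
  assumes "finite I"
    and "\<And>s t. (s, t) \<in> I \<Longrightarrow> a \<le> s \<and> s < t \<and> t \<le> b"
    and "pairwise (\<lambda>i j. disjnt {fst i..snd i} {fst j..snd j}) I"
    and "mono_on {a..b} F" and "a \<le> b"
  shows "(\<Sum>i\<in>I. F (snd i) - F (fst i)) \<le> F b - F a"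
  using assms
proof (induction arbitrary: b rule: finite_ranking_induct[where f = snd])
  case empty
  then show ?case by (simp add: mono_on_def)
next
  case (insert x S)
  obtain p q where x: "x = (p, q)" by force
  have pq: "a \<le> p" "p < q" "q \<le> b" using insert.prems(1) x by auto
  have F: "F p \<le> F q" "F q \<le> F b" "F a \<le> F p"
    using pq insert.prems(3) by (auto simp: mono_on_def)
  show ?case
  proof (cases "x \<in> S")
    case True
    then show ?thesis
      using insert.IH[of b] insert.prems by (simp add: insert_absorb)
  next
    case False
    have "(\<Sum>i\<in>S. F (snd i) - F (fst i)) \<le> F p - F a"
    proof (rule insert.IH)
      show "a \<le> s \<and> s < t \<and> t \<le> p" if "(s, t) \<in> S" for s t
      proof -
        have "disjnt {s..t} {p..q}"
          using insert.prems(2) that False x by (force simp: pairwise_def)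
        moreover have "a \<le> s" "s < t" "t \<le> q"
          using insert.prems(1) that insert.hyps(2)[OF that] x by auto
        moreover have "t \<notin> {p..q}"
          using calculation by (auto simp: disjnt_iff)
        ultimately show ?thesis using pq by auto
      qed
      show "pairwise (\<lambda>i j. disjnt {fst i..snd i} {fst j..snd j}) S"
        using insert.prems(2) by (meson pairwise_mono subset_insertI subset_refl pairwise_subset)
      show "mono_on {a..p} F"
        using insert.prems(3) pq by (auto intro: mono_on_subset)
    qed (use pq in auto)
    then show ?thesis
      using F False insert.hyps(1) by (simp add: x)
  qed
qed

text \<open>This is the weak-type estimate behind the differentiation of monotone functions: the points
  near which \<open>D\<close> exceeds \<open>\<epsilon>\<close> times the length are finely covered by such intervals, a disjoint
  Vitali subfamily exhausts them, and its total length is at most the increase of \<open>F\<close> divided by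
  \<open>\<epsilon>\<close>. As the set of these points may fail to be measurable, it is shown to be null through its outer
  measure. Intervals that merely contain the point are admitted so that the left and the right
  derivative are treated together.\<close>

lemma interval_quotient_tendsto_0_AE:
  fixes D :: "real \<Rightarrow> real \<Rightarrow> real"
  assumes control: "\<And>\<eta>. \<eta> > 0 \<Longrightarrow> \<exists>P F. finite P \<and> mono_on {a..b} F \<and> F b - F a \<le> \<eta> \<and>
      (\<forall>s t. a \<le> s \<and> s < t \<and> t \<le> b \<and> P \<inter> {s<..<t} = {} \<longrightarrow> D s t \<le> F t - F s)"
  shows "\<exists>N. negligible N \<and> (\<forall>x\<in>{a<..<b} - N. \<forall>\<epsilon>>0. \<exists>\<delta>>0. \<forall>s t.
      a \<le> s \<and> s \<le> x \<and> x \<le> t \<and> t \<le> b \<and> s < t \<and> t - s < \<delta> \<longrightarrow> D s t < \<epsilon> * (t - s))"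
proof -
  define bad where "bad \<epsilon> = {x \<in> {a<..<b}. \<forall>\<delta>>0. \<exists>s t.
      a \<le> s \<and> s \<le> x \<and> x \<le> t \<and> t \<le> b \<and> s < t \<and> t - s < \<delta> \<and> \<epsilon> * (t - s) \<le> D s t}" for \<epsilon>
  have neg: "negligible (bad \<epsilon>)" if "\<epsilon> > 0" for \<epsilon>
    unfolding negligible_outer_le
  proof (intro allI impI)
    fix e :: real assume "e > 0"
    show "\<exists>T. bad \<epsilon> \<subseteq> T \<and> T \<in> lmeasurable \<and> measure lebesgue T \<le> e"
    proof (cases "bad \<epsilon> = {}")
      case True
      then show ?thesis using \<open>e > 0\<close> by (intro exI[of _ "{}"]) auto
    next
      case False
      then have ab: "a < b" by (auto simp: bad_def)
      obtain P F where P: "finite P" and F: "mono_on {a..b} F" "F b - F a \<le> \<epsilon> * e"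
        and PF: "\<And>s t. \<lbrakk>a \<le> s; s < t; t \<le> b; P \<inter> {s<..<t} = {}\<rbrakk> \<Longrightarrow> D s t \<le> F t - F s"
        using control[of "\<epsilon> * e"] mult_pos_pos[OF \<open>\<epsilon> > 0\<close> \<open>e > 0\<close>] by auto
      \<comment> \<open>The Vitali family. It avoids the cut points in the interior of its members, so it covers
      finely only the bad points outside \<open>P\<close>; \<open>P\<close> itself is negligible.\<close>
      define K where "K = {(s, t). a \<le> s \<and> s < t \<and> t \<le> b \<and> P \<inter> {s<..<t} = {} \<and> \<epsilon> * (t - s) \<le> D s t}"
      let ?c = "\<lambda>i. (fst i + snd i) / 2 :: real" and ?r = "\<lambda>i. (snd i - fst i) / 2 :: real"
      have cball: "cball (?c i) (?r i) = {fst i..snd i}" for i :: "real \<times> real"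
        unfolding cball_eq_atLeastAtMost by (simp add: field_simps)
      obtain C where C: "countable C" "C \<subseteq> K"
        and disj: "pairwise (\<lambda>i j. disjnt {fst i..snd i} {fst j..snd j}) C"
        and negC: "negligible ((bad \<epsilon> - P) - (\<Union>i\<in>C. {fst i..snd i}))"
      proof (rule Vitali_covering_theorem_cballs[of K ?r "bad \<epsilon> - P" ?c, unfolded cball])
        show "0 < ?r i" if "i \<in> K" for i using that by (auto simp: K_def)
        fix x d :: real assume x: "x \<in> bad \<epsilon> - P" and "0 < d"
        obtain d' where d': "d' > 0" "\<And>y. y \<in> P \<Longrightarrow> y \<noteq> x \<Longrightarrow> d' \<le> dist x y"
          using finite_set_avoid[OF P, of x] by blast
        have "\<exists>s t. a \<le> s \<and> s \<le> x \<and> x \<le> t \<and> t \<le> b \<and> s < t \<and> t - s < min d d' \<and> \<epsilon> * (t - s) \<le> D s t"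
        proof -
          have "min d d' > 0" using \<open>0 < d\<close> \<open>d' > 0\<close> by simp
          then show ?thesis using x unfolding bad_def by blast
        qed
        then obtain s t where st: "a \<le> s" "s \<le> x" "x \<le> t" "t \<le> b" "s < t" "t - s < min d d'"
            "\<epsilon> * (t - s) \<le> D s t"
          by blast
        have "P \<inter> {s<..<t} = {}"
        proof (rule ccontr)
          assume "P \<inter> {s<..<t} \<noteq> {}"
          then obtain y where "y \<in> P" "s < y" "y < t" by auto
          moreover from this have "y \<noteq> x" using x by auto
          ultimately show False using d'(2)[of y] st by (auto simp: dist_real_def)
        qed
        then have "(s, t) \<in> K" using st by (auto simp: K_def)
        then show "\<exists>i. i \<in> K \<and> x \<in> {fst i..snd i} \<and> ?r i < d"
          using st by (intro exI[of _ "(s, t)"]) auto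
      qed (rule that)
      have meas: "(\<Union>i\<in>C. {fst i..snd i}) \<in> lmeasurable \<and>
          measure lebesgue (\<Union>i\<in>C. {fst i..snd i}) \<le> e"
      proof -
        have fin: "measure lebesgue (\<Union>i\<in>J. {fst i..snd i}) \<le> e" if J: "finite J" "J \<subseteq> C" for J
        proof -
          have JK: "a \<le> s \<and> s < t \<and> t \<le> b \<and> P \<inter> {s<..<t} = {} \<and> \<epsilon> * (t - s) \<le> D s t"
            if "(s, t) \<in> J" for s t
            using that J C by (auto simp: K_def)
          have "\<epsilon> * measure lebesgue (\<Union>i\<in>J. {fst i..snd i})
              \<le> \<epsilon> * (\<Sum>i\<in>J. measure lebesgue {fst i..snd i})"
            using \<open>\<epsilon> > 0\<close> J by (intro mult_left_mono measure_UNION_le) auto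
          also have "\<dots> = (\<Sum>i\<in>J. \<epsilon> * (snd i - fst i))"
            unfolding sum_distrib_left
          proof (rule sum.cong)
            fix i assume "i \<in> J"
            then have "(fst i, snd i) \<in> J" by simp
            then show "\<epsilon> * measure lebesgue {fst i..snd i} = \<epsilon> * (snd i - fst i)"
              using JK[of "fst i" "snd i"] by simp
          qed simp
          also have "\<dots> \<le> (\<Sum>i\<in>J. F (snd i) - F (fst i))"
          proof (rule sum_mono)
            fix i assume "i \<in> J"
            then have i: "(fst i, snd i) \<in> J" by simp
            show "\<epsilon> * (snd i - fst i) \<le> F (snd i) - F (fst i)"
              using JK[OF i] PF[of "fst i" "snd i"] by linarith
          qed
          also have "\<dots> \<le> F b - F a"
          proof (rule sum_increments_le)
            show "pairwise (\<lambda>i j. disjnt {fst i..snd i} {fst j..snd j}) J"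
              using disj J by (meson pairwise_subset)
          qed (use J JK ab F in auto)
          finally have "\<epsilon> * measure lebesgue (\<Union>i\<in>J. {fst i..snd i}) \<le> \<epsilon> * e"
            using F by linarith
          then show ?thesis using \<open>\<epsilon> > 0\<close> by simp
        qed
        show ?thesis
          using fmeasurable_UN_bound[OF C(1) _ fin] measure_UN_bound[OF C(1) _ fin] by simp
      qed
      have "negligible ((bad \<epsilon> - (\<Union>i\<in>C. {fst i..snd i})))" (is "negligible ?Z")
        by (rule negligible_subset[OF negligible_Un[OF negC negligible_finite[OF P]]]) auto
      then have Z: "?Z \<in> lmeasurable" "measure lebesgue ?Z = 0"
        by (auto simp: negligible_iff_measure)
      let ?U = "\<Union>i\<in>C. {fst i..snd i}"
      have "bad \<epsilon> \<subseteq> ?Z \<union> ?U" by auto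
      moreover have "?Z \<union> ?U \<in> lmeasurable" using Z meas by (intro fmeasurable.Un) auto
      moreover have "measure lebesgue (?Z \<union> ?U) \<le> e"
        using measure_Un_le[of ?Z lebesgue ?U] Z meas by auto
      ultimately show ?thesis by blast
    qed
  qed
  define N where "N = (\<Union>n. bad (inverse (real (Suc n))))"
  have "negligible N" unfolding N_def 
    using neg by (simp add: negligible_iff_null_sets null_sets_UN)
  moreover have "\<exists>\<delta>>0. \<forall>s t.
      a \<le> s \<and> s \<le> x \<and> x \<le> t \<and> t \<le> b \<and> s < t \<and> t - s < \<delta> \<longrightarrow> D s t < \<epsilon> * (t - s)"
    if x: "x \<in> {a<..<b} - N" and "\<epsilon> > 0" for x \<epsilon>
  proof -
    obtain n where n: "inverse (real (Suc n)) < \<epsilon>" using reals_Archimedean \<open>\<epsilon> > 0\<close> by blast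
    have "x \<notin> bad (inverse (real (Suc n)))" using x by (auto simp: N_def)
    then obtain \<delta> where "\<delta> > 0" and \<delta>: "\<And>s t. \<lbrakk>a \<le> s; s \<le> x; x \<le> t; t \<le> b; s < t; t - s < \<delta>\<rbrakk>
        \<Longrightarrow> D s t < inverse (real (Suc n)) * (t - s)"
      using x unfolding bad_def by (fastforce simp: not_le)
    have "D s t < \<epsilon> * (t - s)"
      if "a \<le> s" "s \<le> x" "x \<le> t" "t \<le> b" "s < t" "t - s < \<delta>" for s t
      using \<delta>[OF that] mult_right_mono[OF less_imp_le[OF n], of "t - s"] \<open>s < t\<close> by linarith
    then show ?thesis using \<open>\<delta> > 0\<close> by blast
  qed
  ultimately show ?thesis by blast
qed

section \<open>Averages of an integrable function\<close>

lemma set_lebesgue_integral_Ioo_eq_integral: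
  fixes f :: "real \<Rightarrow> real"
  assumes "set_integrable lebesgue {a<..<b} f" and "a \<le> s" and "t \<le> b"
  shows "(LINT r:{s<..<t}|lebesgue. f r) = integral {s..t} f"
proof -
  have "set_integrable lebesgue {s<..<t} f"
    by (rule set_integrable_subset[OF assms(1)]) (use assms in auto)
  then show ?thesis
    by (simp add: set_lebesgue_integral_eq_integral(2) integral_open_interval_real)
qed

lemma right_average_tendsto_AE:
  fixes f :: "real \<Rightarrow> real"
  assumes "\<And>a b. f integrable_on {a..b}"
  shows "AE x in lebesgue. ((\<lambda>y. integral {x..y} f / (y - x)) \<longlongrightarrow> f x) (at_right x)"
proof -
  obtain N where N: "negligible N"
    and lim: "\<And>x e. \<lbrakk>x \<notin> N; 0 < e\<rbrakk> \<Longrightarrow> \<exists>d>0. \<forall>h. 0 < h \<and> h < d \<longrightarrow>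
        norm (integral (cbox x (x + h *\<^sub>R One)) f /\<^sub>R h ^ DIM(real) - f x) < e"
    using integrable_ccontinuous_explicit[of f] assms by (auto simp: box_real)
  have "((\<lambda>y. integral {x..y} f / (y - x)) \<longlongrightarrow> f x) (at_right x)" if "x \<notin> N" for x
    unfolding tendsto_iff eventually_at_right_field
  proof (intro allI impI)
    fix e :: real assume "e > 0"
    obtain d where "d > 0" and d: "\<And>h. 0 < h \<Longrightarrow> h < d \<Longrightarrow>
        \<bar>integral {x..x + h} f / h - f x\<bar> < e"
      using lim[OF \<open>x \<notin> N\<close> \<open>e > 0\<close>] by (auto simp: divide_inverse mult.commute)
    have "dist (integral {x..y} f / (y - x)) (f x) < e" if "x < y" "y < x + d" for y
      using d[of "y - x"] that by (simp add: dist_real_def)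
    then show "\<exists>b>x. \<forall>y>x. y < b \<longrightarrow> dist (integral {x..y} f / (y - x)) (f x) < e"
      using \<open>d > 0\<close> by (intro exI[of _ "x + d"]) auto
  qed
  then show ?thesis
    using N by (auto simp: negligible_iff_null_sets intro!: AE_I'[of N])
qed

text \<open>The right-sided statement applied to the reflected function.\<close>

lemma left_average_tendsto_AE:
  fixes f :: "real \<Rightarrow> real"
  assumes "\<And>a b. f integrable_on {a..b}"
  shows "AE x in lebesgue. ((\<lambda>y. integral {y..x} f / (x - y)) \<longlongrightarrow> f x) (at_left x)"
proof -
  have "(\<lambda>x. f (- x)) integrable_on {a..b}" for a b
    using Henstock_Kurzweil_Integration.integrable_reflect_real[where f = f and a = "- b" and b = "- a"] assms by simp
  from right_average_tendsto_AE[OF this]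
  obtain N where "N \<in> null_sets lebesgue"
    and N: "\<And>x. x \<notin> N \<Longrightarrow> ((\<lambda>y. integral {x..y} (\<lambda>x. f (- x)) / (y - x)) \<longlongrightarrow> f (- x)) (at_right x)"
    by (auto elim!: AE_E3)
  then have "negligible (uminus ` N)"
    by (intro negligible_differentiable_image_negligible)
      (auto simp: negligible_iff_null_sets intro!: linear_imp_differentiable_on linear_uminus)
  moreover have "((\<lambda>y. integral {y..x} f / (x - y)) \<longlongrightarrow> f x) (at_left x)" if "x \<notin> uminus ` N" for x
  proof -
    have "- x \<notin> N" using that by force
    from N[OF this] have "((\<lambda>y. integral {- x..y} (\<lambda>x. f (- x)) / (y - - x)) \<longlongrightarrow> f x) (at_right (- x))"
      by simp
    moreover have "integral {- x..y} (\<lambda>x. f (- x)) = integral {- y..x} f" for y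
      using Henstock_Kurzweil_Integration.integral_reflect_real[where f = f and a = "- y" and b = x]
      by simp
    ultimately show ?thesis by (simp add: filterlim_at_left_to_right[of _ _ x] add.commute)
  qed
  ultimately show ?thesis
    by (auto simp: negligible_iff_null_sets intro!: AE_I'[of "uminus ` N"])
qed

section \<open>Densities of dominated monotone functions\<close>

text \<open>The fundamental theorem of calculus for a monotone function dominated by an integral. The
  Stieltjes measure \<open>\<nu>\<close> of \<open>G\<close> is a summand of the measure with density \<open>\<bar>k\<bar>\<close>, the other summand
  being the Stieltjes measure of the primitive of \<open>\<bar>k\<bar>\<close> minus \<open>G\<close>, which is monotone as well.
  Hence \<open>\<nu>\<close> is absolutely continuous, and \<open>m\<close> is its Radon-Nikodym derivative.\<close>

lemma dominated_increments_eq_integral: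
  fixes G k :: "real \<Rightarrow> real"
  assumes "a \<le> b" and k: "k absolutely_integrable_on {a..b}"
    and G: "\<And>s t. \<lbrakk>a \<le> s; s \<le> t; t \<le> b\<rbrakk> \<Longrightarrow> G s \<le> G t \<and> G t - G s \<le> integral {s..t} k"
  obtains m where "integrable lebesgue m"
    and "\<And>s t. \<lbrakk>a \<le> s; s \<le> t; t \<le> b\<rbrakk> \<Longrightarrow> G t - G s = integral {s..t} m"
proof -
  \<comment> \<open>Stieltjes measures need functions on the whole line: \<open>G\<close> and the primitive of \<open>\<bar>k\<bar>\<close> are extended by
      constants outside \<open>[a, b]\<close>, through the projection \<open>c\<close> onto that interval.\<close>
  define c where "c t = max a (min b t)" for t
  have c: "a \<le> c t" "c t \<le> b" for t using \<open>a \<le> b\<close> by (auto simp: c_def)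
  have c_mono: "c s \<le> c t" if "s \<le> t" for s t using that by (auto simp: c_def)
  have c_id: "c t = t" if "t \<in> {a..b}" for t using that by (auto simp: c_def)
  define K where "K t = integral {a..c t} (\<lambda>x. \<bar>k x\<bar>)" for t
  define H where "H t = G (c t)" for t
  have abs_k: "(\<lambda>x. \<bar>k x\<bar>) integrable_on {s..t}" "k integrable_on {s..t}" if "a \<le> s" "t \<le> b" for s t
  proof -
    have "k absolutely_integrable_on {s..t}"
      using set_integrable_subset[OF k] that by auto
    then show "(\<lambda>x. \<bar>k x\<bar>) integrable_on {s..t}" "k integrable_on {s..t}"
      by (auto simp: absolutely_integrable_on_def)
  qed
  have K_diff: "K t - K s = integral {c s..c t} (\<lambda>x. \<bar>k x\<bar>)" if "s \<le> t" for s t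
    using Henstock_Kurzweil_Integration.integral_combine[of a "c s" "c t" "\<lambda>x. \<bar>k x\<bar>"] c[of s] c[of t] c_mono[OF that] abs_k
    by (simp add: K_def)
  have H: "H s \<le> H t" "H t - H s \<le> K t - K s" if "s \<le> t" for s t
  proof -
    have "G (c s) \<le> G (c t) \<and> G (c t) - G (c s) \<le> integral {c s..c t} k"
      by (intro G c c_mono that)
    moreover have "integral {c s..c t} k \<le> integral {c s..c t} (\<lambda>x. \<bar>k x\<bar>)"
      by (intro integral_le abs_k c) auto
    ultimately show "H s \<le> H t" "H t - H s \<le> K t - K s"
      using K_diff[OF that] by (auto simp: H_def)
  qed
  have "continuous_on {a..b} (\<lambda>t. integral {a..t} (\<lambda>x. \<bar>k x\<bar>))"
    using abs_k[of a b] by (intro indefinite_integral_continuous_1) auto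
  then have "continuous_on UNIV K"
    unfolding K_def by (rule continuous_on_compose2) (use \<open>a \<le> b\<close> in \<open>auto simp: c_def[abs_def] intro!: continuous_intros\<close>)
  then have K_cont: "(K \<longlongrightarrow> K x) (at_right x)" for x
    by (simp add: continuous_on_eq_continuous_at isCont_def filterlim_at_split)
  have H_cont: "(H \<longlongrightarrow> H x) (at_right x)" for x
  proof (rule tendsto_sandwich[OF _ _ tendsto_const])
    show "\<forall>\<^sub>F y in at_right x. H x \<le> H y"
      unfolding eventually_at_right_field using H(1) by (auto intro!: exI[of _ "x + 1"])
    show "\<forall>\<^sub>F y in at_right x. H y \<le> H x + (K y - K x)"
    proof -
      have "H y \<le> H x + (K y - K x)" if "x < y" for y using H(2)[of x y] that by linarith
      then show ?thesis unfolding eventually_at_right_field by (auto intro!: exI[of _ "x + 1"])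
    qed
    show "((\<lambda>y. H x + (K y - K x)) \<longlongrightarrow> H x) (at_right x)"
      by (rule tendsto_eq_intros K_cont refl | simp)+
  qed
  define \<nu> where "\<nu> = interval_measure H"
  define \<eta> where "\<eta> = interval_measure (\<lambda>x. K x - H x)"
  have sets[simp]: "sets \<nu> = sets borel" "sets \<eta> = sets borel" by (auto simp: \<nu>_def \<eta>_def)
  have \<nu>: "emeasure \<nu> {s<..t} = ennreal (H t - H s)" if "s \<le> t" for s t
    unfolding \<nu>_def using that H(1) H_cont
    by (intro emeasure_interval_measure_Ioc) (auto simp: continuous_within)
  have \<eta>: "emeasure \<eta> {s<..t} = ennreal (K t - H t - (K s - H s))" if "s \<le> t" for s t
    unfolding \<eta>_def
  proof (rule emeasure_interval_measure_Ioc[OF that])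
    show "K x - H x \<le> K y - H y" if "x \<le> y" for x y using H(2)[OF that] by simp
    show "continuous (at_right x) (\<lambda>x. K x - H x)" for x
      using H_cont K_cont by (auto simp: continuous_within intro!: tendsto_diff)
  qed
  \<comment> \<open>\<open>\<bar>k\<bar>\<close> is only Lebesgue measurable, while Stieltjes measures live on Borel sets: the measure
      with this density is pushed forward along the identity into the Borel \<open>\<sigma>\<close>-algebra.\<close>
  define k0 where "k0 x = indicator {a..b} x *\<^sub>R \<bar>k x\<bar>" for x
  have k0: "integrable lebesgue k0"
    using set_integrable_abs[OF k] by (simp add: set_integrable_def k0_def[abs_def])
  have k0_eq: "k0 = (\<lambda>x. if x \<in> {a..b} then \<bar>k x\<bar> else 0)"
    by (auto simp: k0_def fun_eq_iff)
  have [measurable]: "k0 \<in> borel_measurable lebesgue" using k0 by blast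
  define \<mu> where "\<mu> = distr (density lebesgue (\<lambda>x. ennreal (k0 x))) borel (\<lambda>x. x)"
  have \<mu>_eq: "emeasure \<mu> A = (\<integral>\<^sup>+x. ennreal (k0 x) * indicator A x \<partial>lebesgue)" if "A \<in> sets borel" for A
    using that unfolding \<mu>_def
    by (subst emeasure_distr) (auto simp: emeasure_density measurable_completion)
  have \<mu>: "emeasure \<mu> {s<..t} = ennreal (K t - K s)" if "s \<le> t" for s t
  proof -
    have *: "((\<lambda>x. \<bar>k x\<bar>) has_integral (K t - K s)) {c s..c t}"
      unfolding K_diff[OF that] by (intro integrable_integral abs_k c)
    have "{c s..c t} - {s<..t} \<inter> {a..b} \<subseteq> {c s}" "{s<..t} \<inter> {a..b} - {c s..c t} = {}"
      using \<open>a \<le> b\<close> that by (auto simp: c_def max_def min_def split: if_splits)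
    then have "{x \<in> {c s..c t} - {s<..t} \<inter> {a..b}. \<bar>k x\<bar> \<noteq> 0} \<subseteq> {c s}"
      "{x \<in> {s<..t} \<inter> {a..b} - {c s..c t}. \<bar>k x\<bar> \<noteq> 0} \<subseteq> {c s}"
      by blast+
    then have "negligible {x \<in> {c s..c t} - {s<..t} \<inter> {a..b}. \<bar>k x\<bar> \<noteq> 0}"
      "negligible {x \<in> {s<..t} \<inter> {a..b} - {c s..c t}. \<bar>k x\<bar> \<noteq> 0}"
      using negligible_subset[OF negligible_sing] by metis+
    from has_integral_spike_set_eq[OF this]
    have "((\<lambda>x. \<bar>k x\<bar>) has_integral (K t - K s)) ({s<..t} \<inter> {a..b})"
      using * by blast
    then have "((\<lambda>x. \<bar>k x\<bar>) has_integral (K t - K s)) ({a..b} \<inter> {s<..t})"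
      by (simp add: Int_commute)
    then have "(k0 has_integral (K t - K s)) {s<..t}"
      unfolding k0_eq has_integral_restrict_Int .
    from nn_integral_has_integral_lebesgue'[OF _ this] show ?thesis
      by (simp add: \<mu>_eq k0_def nn_integral_completion)
  qed
  define \<sigma> where "\<sigma> = measure_of UNIV (sets borel) (\<lambda>A. emeasure \<nu> A + emeasure \<eta> A)"
  have [simp]: "sets \<sigma> = sets borel"
    by (simp add: \<sigma>_def sets_measure_of_conv) (metis sets.sigma_sets_eq space_borel)
  have \<sigma>: "emeasure \<sigma> A = emeasure \<nu> A + emeasure \<eta> A" if "A \<in> sets borel" for A
  proof (rule emeasure_measure_of[OF \<sigma>_def])
    show "countably_additive (sets \<sigma>) (\<lambda>A. emeasure \<nu> A + emeasure \<eta> A)"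
      by (auto simp: countably_additive_def suminf_add[symmetric] suminf_emeasure)
  qed (use that in \<open>auto simp: positive_def\<close>)
  have "\<sigma> = \<mu>"
  proof (rule measure_eqI_generator_eq[where E = "range (\<lambda>(s, t). {s<..t})" and \<Omega> = UNIV and A = "\<lambda>i. {- real i<..real i}"])
    show "Int_stable (range (\<lambda>(s, t). {s<..t :: real}))"
      by (auto simp: Int_stable_def intro!: rangeI image_eqI[of _ _ "(max _ _, min _ _)"])
    show "emeasure \<sigma> X = emeasure \<mu> X" if X_range: "X \<in> range (\<lambda>(s, t). {s<..t})" for X
    proof -
      obtain s t where X: "X = {s<..t}" using X_range by auto
      show ?thesis
        using H(1)[of s t] H(2)[of s t]
        by (cases "s \<le> t") (auto simp: X \<sigma> \<nu> \<eta> \<mu> simp flip: ennreal_plus)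
    qed
    show "sets \<sigma> = sigma_sets UNIV (range (\<lambda>(s, t). {s<..t}))"
      "sets \<mu> = sigma_sets UNIV (range (\<lambda>(s, t). {s<..t}))"
      by (simp_all add: \<mu>_def, simp_all add: borel_sigma_sets_Ioc)
    show "(\<Union>i. {- real i<..real i}) = UNIV"
    proof -
      have "\<exists>i. - real i < x \<and> x \<le> real i" for x
        using reals_Archimedean2[of "\<bar>x\<bar>"] by (metis abs_less_iff less_imp_le minus_less_iff)
      then show ?thesis by auto
    qed
    show "emeasure \<sigma> {- real i<..real i} \<noteq> \<infinity>" for i
      by (simp add: \<sigma> \<nu> \<eta>)
  qed auto
  then have \<nu>_le: "emeasure \<nu> A \<le> emeasure \<mu> A" if "A \<in> sets borel" for A
    using \<sigma>[OF that] by (metis add.right_neutral add_left_mono zero_le)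
  have "absolutely_continuous lborel \<nu>"
    unfolding absolutely_continuous_def
  proof
    fix A :: "real set" assume A: "A \<in> null_sets lborel"
    then have AE: "AE x in lebesgue. x \<notin> A"
      by (intro AE_completion AE_not_in)
    have "emeasure \<mu> A = (\<integral>\<^sup>+(x::real). 0 \<partial>lebesgue)"
      unfolding \<mu>_eq[of A, OF null_setsD2[OF A, simplified]]
      by (intro nn_integral_cong_AE) (use AE in auto)
    then show "A \<in> null_sets \<nu>" using \<nu>_le[of A] A by (auto simp: null_sets_def)
  qed
  then obtain f where [measurable]: "f \<in> borel_measurable lborel" and f: "density lborel f = \<nu>"
    using sigma_finite_measure.Radon_Nikodym[OF sigma_finite_lborel, of \<nu>] by auto
  have "emeasure \<mu> UNIV < \<infinity>"
    using integrableD(2)[OF k0] by (simp add: \<mu>_eq k0_def top.not_eq_extremum)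
  then have "emeasure \<nu> UNIV < \<infinity>" using \<nu>_le[of UNIV] by (simp add: order.strict_trans1)
  then have f_fin: "(\<integral>\<^sup>+x. f x \<partial>lborel) < \<infinity>"
    by (simp flip: f add: emeasure_density)
  then have f_AE: "AE x in lborel. f x \<noteq> \<infinity>"
    by (intro nn_integral_PInf_AE) auto
  define m where "m x = enn2real (f x)" for x
  have m_AE: "AE x in lborel. ennreal (m x) = f x"
    using f_AE by eventually_elim (auto simp: m_def ennreal_enn2real top.not_eq_extremum)
  have m: "integrable lborel m"
  proof (rule integrableI_nonneg)
    show "(\<integral>\<^sup>+x. ennreal (m x) \<partial>lborel) < \<infinity>"
      using f_fin nn_integral_cong_AE[OF m_AE] by simp
  qed (auto simp: m_def[abs_def])
  show ?thesis
  proof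
    show "integrable lebesgue m" using m by (simp add: integrable_completion)
    fix s t assume st: "a \<le> s" "s \<le> t" "t \<le> b"
    have m_set: "set_integrable lborel {s<..t} m"
      unfolding set_integrable_def using m by (intro integrable_mult_indicator) auto
    have "ennreal (G t - G s) = emeasure \<nu> {s<..t}"
      using \<nu>[OF st(2)] st by (simp add: H_def c_id)
    also have "\<dots> = (\<integral>\<^sup>+x. f x * indicator {s<..t} x \<partial>lborel)"
      by (simp flip: f add: emeasure_density)
    also have "\<dots> = (\<integral>\<^sup>+x. ennreal (indicator {s<..t} x *\<^sub>R m x) \<partial>lborel)"
      using m_AE by (intro nn_integral_cong_AE, eventually_elim) (auto simp: indicator_def)
    also have "\<dots> = ennreal (LINT x:{s<..t}|lborel. m x)"
      unfolding set_lebesgue_integral_def using m_set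
      by (intro nn_integral_eq_integral) (auto simp: set_integrable_def m_def)
    finally have "G t - G s = (LINT x:{s<..t}|lborel. m x)"
      using G[OF st] by (subst (asm) ennreal_inj)
        (auto simp: set_lebesgue_integral_def m_def intro!: integral_nonneg_AE)
    also have "\<dots> = integral {s<..t} m"
      by (rule set_borel_integral_eq_integral(2)[OF m_set])
    also have "\<dots> = integral {s..t} m"
      by (rule integral_subset_negligible) (auto intro: negligible_subset[of "{s}"])
    finally show "G t - G s = integral {s..t} m" .
  qed
qed

section \<open>The variation of a subadditive interval function\<close>

text \<open>Partition sums are generated inductively, adding the last interval at each step, so that
  refining, joining and bounding them are inductions that never mention the partition points.\<close>

inductive partition_sum :: "(real \<Rightarrow> real \<Rightarrow> real) \<Rightarrow> real \<Rightarrow> real \<Rightarrow> real \<Rightarrow> bool" for A where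
  single: "s < t \<Longrightarrow> partition_sum A s t (A s t)"
| snoc: "partition_sum A s r v \<Longrightarrow> r < t \<Longrightarrow> partition_sum A s t (v + A r t)"

lemma partition_sum_less: "partition_sum A s t v \<Longrightarrow> s < t"
  by (induction rule: partition_sum.induct) auto

lemma partition_sum_append:
  "partition_sum A r t w \<Longrightarrow> partition_sum A s r v \<Longrightarrow> partition_sum A s t (v + w)"
proof (induction rule: partition_sum.induct)
  case (single r t)
  then show ?case by (auto intro: partition_sum.snoc)
next
  case (snoc r q w t)
  then have "partition_sum A s t (v + w + A q t)" by (intro partition_sum.snoc) auto
  then show ?case by (simp add: add.assoc)
qed

definition variation :: "(real \<Rightarrow> real \<Rightarrow> real) \<Rightarrow> real \<Rightarrow> real \<Rightarrow> real" where
  "variation A s t = Sup {v. partition_sum A s t v}"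

text \<open>In the application \<open>A s t\<close> is the cost of going from \<open>u s\<close> to \<open>u t\<close> in time \<open>t - s\<close>.\<close>

locale dominated_interval_function =
  fixes A :: "real \<Rightarrow> real \<Rightarrow> real" and a b :: real and k :: "real \<Rightarrow> real"
  assumes a_less_b: "a < b"
    and k: "k absolutely_integrable_on {a..b}"
    and nonneg: "\<lbrakk>a \<le> s; s < t; t \<le> b\<rbrakk> \<Longrightarrow> 0 \<le> A s t"
    and subadditive: "\<lbrakk>a \<le> s; s < r; r < t; t \<le> b\<rbrakk> \<Longrightarrow> A s t \<le> A s r + A r t"
    and dominated: "\<lbrakk>a \<le> s; s < t; t \<le> b\<rbrakk> \<Longrightarrow> A s t \<le> integral {s..t} k"
begin

lemma partition_sum_le_integral:
  "partition_sum A s t v \<Longrightarrow> a \<le> s \<Longrightarrow> t \<le> b \<Longrightarrow> v \<le> integral {s..t} k"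
proof (induction rule: partition_sum.induct)
  case (single s t)
  then show ?case by (intro dominated)
next
  case (snoc s r v t)
  have "s < r" using snoc.hyps(1) by (rule partition_sum_less)
  have "k integrable_on {s..t}"
    using set_integrable_subset[OF k, of "{s..t}"] snoc.prems by (auto simp: absolutely_integrable_on_def)
  then have "integral {s..r} k + integral {r..t} k = integral {s..t} k"
    using \<open>s < r\<close> \<open>r < t\<close> by (intro Henstock_Kurzweil_Integration.integral_combine) auto
  moreover have "v \<le> integral {s..r} k" using snoc by auto
  moreover have "A r t \<le> integral {r..t} k"
    using snoc.prems snoc.hyps \<open>s < r\<close> by (intro dominated) auto
  ultimately show ?case by linarith
qed

text \<open>Inserting a point into a partition does not decrease the sum, by subadditivity. This is what
  makes the variation subadditive.\<close>

lemma partition_sum_split: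
  "partition_sum A s t v \<Longrightarrow> a \<le> s \<Longrightarrow> t \<le> b \<Longrightarrow> s < r \<Longrightarrow> r < t \<Longrightarrow>
    \<exists>v1 v2. partition_sum A s r v1 \<and> partition_sum A r t v2 \<and> v \<le> v1 + v2"
proof (induction rule: partition_sum.induct)
  case (single s t)
  then show ?case using subadditive by (blast intro: partition_sum.single)
next
  case (snoc s q v t)
  have "s < q" using snoc.hyps(1) by (rule partition_sum_less)
  consider "r < q" | "r = q" | "q < r" by linarith
  then show ?case
  proof cases
    case 1
    then obtain v1 v2 where "partition_sum A s r v1" "partition_sum A r q v2" "v \<le> v1 + v2"
      using snoc.IH snoc.prems snoc.hyps by auto
    then show ?thesis
      using partition_sum.snoc[of A r q v2 t] snoc.hyps by (intro exI[of _ v1] exI[of _ "v2 + A q t"]) auto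
  next
    case 2
    then show ?thesis using snoc.hyps by (auto intro: partition_sum.single)
  next
    case 3
    have "A q t \<le> A q r + A r t"
      using 3 snoc.prems \<open>s < q\<close> by (intro subadditive) auto
    then show ?thesis
      using partition_sum.snoc[OF snoc.hyps(1) 3] snoc.prems
      by (intro exI[of _ "v + A q r"] exI[of _ "A r t"]) (auto intro: partition_sum.single)
  qed
qed

lemma partition_sum_le_variation:
  assumes "partition_sum A s t v" "a \<le> s" "t \<le> b"
  shows "v \<le> variation A s t"
  unfolding variation_def using assms partition_sum_le_integral
  by (intro cSup_upper bdd_aboveI[of _ "integral {s..t} k"]) auto

lemma variation_least:
  assumes "s < t" "\<And>v. partition_sum A s t v \<Longrightarrow> v \<le> c"
  shows "variation A s t \<le> c"
  unfolding variation_def using assms partition_sum.single[of s t A]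
  by (intro cSup_least) auto

lemma le_variation: "\<lbrakk>a \<le> s; s < t; t \<le> b\<rbrakk> \<Longrightarrow> A s t \<le> variation A s t"
  by (intro partition_sum_le_variation partition_sum.single)

lemma variation_le_integral: "\<lbrakk>a \<le> s; s < t; t \<le> b\<rbrakk> \<Longrightarrow> variation A s t \<le> integral {s..t} k"
  by (intro variation_least partition_sum_le_integral)

text \<open>Splitting a partition at \<open>r\<close> gives one inequality, joining two partitions gives the other.\<close>

lemma variation_add:
  assumes "a \<le> s" "s < r" "r < t" "t \<le> b"
  shows "variation A s t = variation A s r + variation A r t"
proof (rule antisym)
  show "variation A s t \<le> variation A s r + variation A r t"
  proof (rule variation_least)
    fix v assume "partition_sum A s t v"
    then obtain v1 v2 where v: "partition_sum A s r v1" "partition_sum A r t v2" "v \<le> v1 + v2"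
      using partition_sum_split assms by blast
    then show "v \<le> variation A s r + variation A r t"
      using partition_sum_le_variation[OF v(1)] partition_sum_le_variation[OF v(2)] assms by auto
  qed (use assms in simp)
  have "variation A r t \<le> variation A s t - v" if "partition_sum A s r v" for v
    using partition_sum_le_variation[OF partition_sum_append[OF _ that]] assms
    by (intro variation_least) (auto simp: field_simps)
  then have "variation A s r \<le> variation A s t - variation A r t"
    using assms by (intro variation_least) (auto simp: field_simps)
  then show "variation A s r + variation A r t \<le> variation A s t" by simp
qed

text \<open>The variation is additive and \<open>A\<close> subadditive, so their difference is superadditive. It is
  this difference that will be shown to be negligible on small intervals.\<close>

definition defect :: "real \<Rightarrow> real \<Rightarrow> real" where
  "defect s t = variation A s t - A s t"

lemma defect_superadditive:
  "\<lbrakk>a \<le> s; s < r; r < t; t \<le> b\<rbrakk> \<Longrightarrow> defect s r + defect r t \<le> defect s t"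
  using subadditive[of s r t] variation_add[of s r t] by (simp add: defect_def)

lemma defect_nonneg: "\<lbrakk>a \<le> s; s < t; t \<le> b\<rbrakk> \<Longrightarrow> 0 \<le> defect s t"
  using le_variation[of s t] by (simp add: defect_def)

text \<open>Superadditivity makes the defect of a growing interval a monotone function of its endpoint
  whose increments bound the defects of the intervals in between. The clause \<open>x \<le> r\<close> supplies the
  starting value at \<open>x = r\<close>, where the interval is degenerate.\<close>

definition defect_from :: "real \<Rightarrow> real \<Rightarrow> real" where
  "defect_from r x = (if x \<le> r then 0 else defect r x)"

lemma defect_le_diff_defect_from:
  assumes "a \<le> r" "r \<le> x" "x < y" "y \<le> b"
  shows "defect x y \<le> defect_from r y - defect_from r x"
  using assms defect_superadditive[of r x y] by (cases "x = r") (auto simp: defect_from_def)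

lemma mono_on_defect_from:
  assumes "a \<le> r" "t \<le> b"
  shows "mono_on {r..t} (defect_from r)"
proof (rule mono_onI)
  fix x y assume "x \<in> {r..t}" "y \<in> {r..t}" "x \<le> y"
  then show "defect_from r x \<le> defect_from r y"
    using defect_le_diff_defect_from[of r x y] defect_nonneg[of x y] assms by (cases "x = y") auto
qed

text \<open>The defects of all intervals that do not cross a partition point are controlled by one
  monotone function, whose total increase is the amount by which the partition sum falls short of
  the variation: on each cell of the partition the function is \<open>defect_from\<close> its left endpoint, and
  the pieces are glued to one monotone function.\<close>

lemma partition_sum_control:
  "partition_sum A s t v \<Longrightarrow> a \<le> s \<Longrightarrow> t \<le> b \<Longrightarrow>
    \<exists>P F. finite P \<and> mono_on {s..t} F \<and> F t - F s = variation A s t - v \<and>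
      (\<forall>x y. s \<le> x \<and> x < y \<and> y \<le> t \<and> P \<inter> {x<..<y} = {} \<longrightarrow> defect x y \<le> F y - F x)"
proof (induction rule: partition_sum.induct)
  case (single s t)
  then show ?case
  proof (intro exI[of _ "{}"] exI[of _ "defect_from s"] conjI allI impI)
    show "mono_on {s..t} (defect_from s)" using single by (intro mono_on_defect_from)
    show "defect_from s t - defect_from s s = variation A s t - A s t"
      using single by (simp add: defect_from_def defect_def)
    show "defect x y \<le> defect_from s y - defect_from s x"
      if "s \<le> x \<and> x < y \<and> y \<le> t \<and> {} \<inter> {x<..<y} = {}" for x y
      using that single by (intro defect_le_diff_defect_from) auto
  qed simp
next
  case (snoc s r v t)
  have sr: "s < r" using snoc.hyps(1) by (rule partition_sum_less)
  obtain P F where P: "finite P" and F: "mono_on {s..r} F" "F r - F s = variation A s r - v"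
    and PF: "\<And>x y. \<lbrakk>s \<le> x; x < y; y \<le> r; P \<inter> {x<..<y} = {}\<rbrakk> \<Longrightarrow> defect x y \<le> F y - F x"
    using snoc.IH snoc.prems snoc.hyps by auto
  let ?E = "defect_from r"
  have E: "mono_on {r..t} ?E" "\<And>x y. \<lbrakk>r \<le> x; x < y; y \<le> t\<rbrakk> \<Longrightarrow> defect x y \<le> ?E y - ?E x"
    using mono_on_defect_from[of r t] defect_le_diff_defect_from[of r] sr snoc.prems by auto
  have [simp]: "?E x = 0" if "x \<le> r" for x using that by (simp add: defect_from_def)
  \<comment> \<open>Beyond \<open>r\<close> the function \<open>F\<close> keeps its value at \<open>r\<close>, and the new piece, which vanishes up
      to \<open>r\<close>, takes over.\<close>
  define F' where "F' x = F (min x r) + ?E x" for x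
  have "mono_on {s..t} F'"
  proof (rule mono_onI)
    fix x y assume xy: "x \<in> {s..t}" "y \<in> {s..t}" "x \<le> y"
    have "F (min x r) \<le> F (min y r)"
      using F(1) xy sr by (auto intro!: mono_onD[OF F(1)])
    moreover have "?E (max x r) \<le> ?E (max y r)"
      using E(1) xy \<open>r < t\<close> by (auto intro!: mono_onD[OF E(1)])
    moreover have "?E x = ?E (max x r)" for x by (auto simp: max_def)
    ultimately show "F' x \<le> F' y" by (simp add: F'_def) 
  qed
  moreover have "F' t - F' s = variation A s t - (v + A r t)"
    using F(2) sr snoc.hyps snoc.prems variation_add[of s r t] by (simp add: F'_def defect_from_def defect_def)
  moreover have "defect x y \<le> F' y - F' x"
    if "s \<le> x" "x < y" "y \<le> t" "insert r P \<inter> {x<..<y} = {}" for x y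
  proof (cases "y \<le> r")
    case True
    then show ?thesis using PF[of x y] that by (simp add: F'_def)
  next
    case False
    then have "r \<le> x" using that by (auto simp: not_le)
    then show ?thesis using E(2)[of x y] that False by (simp add: F'_def)
  qed
  ultimately show ?case
    using P by (intro exI[of _ "insert r P"] exI[of _ F']) auto
qed

text \<open>The variation is a supremum of partition sums, so the control functions above can be chosen
  with arbitrarily small increase.\<close>

lemma defect_quotient_tendsto_0_AE:
  "\<exists>N. negligible N \<and> (\<forall>x\<in>{a<..<b} - N. \<forall>\<epsilon>>0. \<exists>\<delta>>0. \<forall>s t.
      a \<le> s \<and> s \<le> x \<and> x \<le> t \<and> t \<le> b \<and> s < t \<and> t - s < \<delta> \<longrightarrow> defect s t < \<epsilon> * (t - s))"
proof (rule interval_quotient_tendsto_0_AE)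
  fix \<eta> :: real assume "\<eta> > 0"
  have "\<exists>v. partition_sum A a b v \<and> variation A a b - \<eta> < v"
  proof (rule ccontr)
    assume "\<not> ?thesis"
    then have "v \<le> variation A a b - \<eta>" if "partition_sum A a b v" for v
      using that by (meson not_le)
    then have "variation A a b \<le> variation A a b - \<eta>"
      by (rule variation_least[OF a_less_b])
    then show False using \<open>\<eta> > 0\<close> by simp
  qed
  then obtain v where v: "partition_sum A a b v" "variation A a b - v \<le> \<eta>" by force
  then show "\<exists>P F. finite P \<and> mono_on {a..b} F \<and> F b - F a \<le> \<eta> \<and>
      (\<forall>s t. a \<le> s \<and> s < t \<and> t \<le> b \<and> P \<inter> {s<..<t} = {} \<longrightarrow> defect s t \<le> F t - F s)"
    using partition_sum_control[OF v(1) order_refl order_refl] by (elim exE conjE) (intro exI conjI; simp)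
qed

text \<open>The density is that of the variation, \<open>variation A s t = integral {s..t} m\<close>. Its averages
  tend to \<open>m x\<close> by Lebesgue differentiation, and those of \<open>A\<close> differ from them by averages of the
  defect, which tend to zero.\<close>

lemma density_exists:
  obtains m where "integrable lebesgue m"
    and "\<And>s t. \<lbrakk>a \<le> s; s < t; t \<le> b\<rbrakk> \<Longrightarrow> A s t \<le> integral {s..t} m"
    and "AE x\<in>{a<..<b} in lebesgue. ((\<lambda>y. A x y / (y - x)) \<longlongrightarrow> m x) (at_right x)"
    and "AE x\<in>{a<..<b} in lebesgue. ((\<lambda>y. A y x / (x - y)) \<longlongrightarrow> m x) (at_left x)"
proof -
  define G where "G t = (if t \<le> a then 0 else variation A a t)" for t
  have G_diff: "G t - G s = variation A s t" if "a \<le> s" "s < t" "t \<le> b" for s t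
    using that variation_add[of a s t] by (cases "a = s") (auto simp: G_def)
  have V_nonneg: "0 \<le> variation A s t" if "a \<le> s" "s < t" "t \<le> b" for s t
    using le_variation[OF that] nonneg[OF that] by simp
  have "G s \<le> G t \<and> G t - G s \<le> integral {s..t} k" if "a \<le> s" "s \<le> t" "t \<le> b" for s t
    using G_diff[of s t] V_nonneg[of s t] variation_le_integral[of s t] that by (cases "s = t") auto
  then obtain m where m: "integrable lebesgue m"
    and Gm: "\<And>s t. \<lbrakk>a \<le> s; s \<le> t; t \<le> b\<rbrakk> \<Longrightarrow> G t - G s = integral {s..t} m"
    using dominated_increments_eq_integral[OF less_imp_le[OF a_less_b] k, of G] by blast
  have V: "variation A s t = integral {s..t} m" if "a \<le> s" "s < t" "t \<le> b" for s t
    using Gm[of s t] G_diff[of s t] that by simp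
  have m_int: "m integrable_on {s..t}" for s t
    using integrable_on_lebesgue[OF m] integrable_on_subinterval by blast
  obtain N where N: "negligible N" and small: "\<And>x \<epsilon>. \<lbrakk>x \<in> {a<..<b} - N; \<epsilon> > 0\<rbrakk> \<Longrightarrow> \<exists>\<delta>>0. \<forall>s t.
      a \<le> s \<and> s \<le> x \<and> x \<le> t \<and> t \<le> b \<and> s < t \<and> t - s < \<delta> \<longrightarrow> defect s t < \<epsilon> * (t - s)"
    using defect_quotient_tendsto_0_AE by blast
  have AE_N: "AE x in lebesgue. x \<notin> N"
    using N by (intro AE_not_in) (simp add: negligible_iff_null_sets)
  \<comment> \<open>Both one-sided limits at once: the filter moves the interval \<open>[p y, q y]\<close>, which contains
      \<open>x\<close> and shrinks to it.\<close>
  have key: "((\<lambda>y. A (p y) (q y) / (q y - p y)) \<longlongrightarrow> m x) F"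
    if x: "x \<in> {a<..<b} - N"
      and lim: "((\<lambda>y. integral {p y..q y} m / (q y - p y)) \<longlongrightarrow> m x) F"
      and pq: "\<forall>\<^sub>F y in F. a \<le> p y \<and> p y \<le> x \<and> x \<le> q y \<and> q y \<le> b \<and> p y < q y"
      and shrink: "((\<lambda>y. q y - p y) \<longlongrightarrow> 0) F"
    for x :: real and p q :: "real \<Rightarrow> real" and F
  proof -
    have "((\<lambda>y. defect (p y) (q y) / (q y - p y)) \<longlongrightarrow> 0) F"
    proof (rule tendstoI)
      fix \<epsilon> :: real assume "\<epsilon> > 0"
      from small[OF x this] obtain \<delta> where "\<delta> > 0" and \<delta>: "\<forall>s t.
          a \<le> s \<and> s \<le> x \<and> x \<le> t \<and> t \<le> b \<and> s < t \<and> t - s < \<delta> \<longrightarrow> defect s t < \<epsilon> * (t - s)"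
        by (elim exE conjE)
      from order_tendstoD(2)[OF shrink \<open>\<delta> > 0\<close>] pq
      show "\<forall>\<^sub>F y in F. dist (defect (p y) (q y) / (q y - p y)) 0 < \<epsilon>"
      proof eventually_elim
        case (elim y)
        then have "0 \<le> defect (p y) (q y)" "defect (p y) (q y) < \<epsilon> * (q y - p y)" "0 < q y - p y"
          using \<delta> defect_nonneg[of "p y" "q y"] by simp_all
        then show ?case by (simp add: pos_divide_less_eq)
      qed
    qed
    from tendsto_diff[OF lim this]
    have "((\<lambda>y. integral {p y..q y} m / (q y - p y) - defect (p y) (q y) / (q y - p y)) \<longlongrightarrow> m x) F"
      by simp
    moreover have "\<forall>\<^sub>F y in F. integral {p y..q y} m / (q y - p y) - defect (p y) (q y) / (q y - p y)
        = A (p y) (q y) / (q y - p y)"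
      using pq
    proof eventually_elim
      case (elim y)
      then have "integral {p y..q y} m - defect (p y) (q y) = A (p y) (q y)"
        using V[of "p y" "q y"] by (simp add: defect_def)
      then show ?case by (simp flip: diff_divide_distrib)
    qed
    ultimately show ?thesis by (rule Lim_transform_eventually)
  qed
  have right: "((\<lambda>y. A x y / (y - x)) \<longlongrightarrow> m x) (at_right x)"
    if x: "x \<in> {a<..<b} - N" and lim: "((\<lambda>y. integral {x..y} m / (y - x)) \<longlongrightarrow> m x) (at_right x)" for x
  proof (rule key[OF x lim])
    show "\<forall>\<^sub>F y in at_right x. a \<le> x \<and> x \<le> x \<and> x \<le> y \<and> y \<le> b \<and> x < y"
      unfolding eventually_at_right_field using x by (intro exI[of _ b]) auto
    show "((\<lambda>y. y - x) \<longlongrightarrow> 0) (at_right x)"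
      by (rule tendsto_eq_intros refl | simp)+
  qed
  have left: "((\<lambda>y. A y x / (x - y)) \<longlongrightarrow> m x) (at_left x)"
    if x: "x \<in> {a<..<b} - N" and lim: "((\<lambda>y. integral {y..x} m / (x - y)) \<longlongrightarrow> m x) (at_left x)" for x
  proof (rule key[OF x lim])
    show "\<forall>\<^sub>F y in at_left x. a \<le> y \<and> y \<le> x \<and> x \<le> x \<and> x \<le> b \<and> y < x"
      unfolding eventually_at_left_field using x by (intro exI[of _ a]) auto
    show "((\<lambda>y. x - y) \<longlongrightarrow> 0) (at_left x)"
      by (rule tendsto_eq_intros refl | simp)+
  qed
  show ?thesis
  proof
    show "integrable lebesgue m" by (fact m)
    show "A s t \<le> integral {s..t} m" if "a \<le> s" "s < t" "t \<le> b" for s t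
      using le_variation[OF that] V[OF that] by simp
    show "AE x\<in>{a<..<b} in lebesgue. ((\<lambda>y. A x y / (y - x)) \<longlongrightarrow> m x) (at_right x)"
      using AE_N right_average_tendsto_AE[OF m_int] by eventually_elim (auto intro: right)
    show "AE x\<in>{a<..<b} in lebesgue. ((\<lambda>y. A y x / (x - y)) \<longlongrightarrow> m x) (at_left x)"
      using AE_N left_average_tendsto_AE[OF m_int] by eventually_elim (auto intro: left)
  qed
qed

end

section \<open>The action density\<close>

lemma set_integrable_of_integrable:
  fixes f :: "real \<Rightarrow> real"
  assumes "integrable lebesgue f" and "S \<in> sets lebesgue"
  shows "set_integrable lebesgue S f"
  unfolding set_integrable_def using assms by (intro integrable_mult_indicator)

text \<open>Functions given on \<open>(a, b)\<close> only are extended by zero, which makes the results on integrable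
  functions on the line available; integrals over subintervals are unchanged.\<close>

lemma set_integrable_Ioo_extend:
  fixes g :: "real \<Rightarrow> real"
  assumes "set_integrable lebesgue {a<..<b} g"
  defines "h \<equiv> \<lambda>x. indicator {a<..<b} x *\<^sub>R g x"
  shows "integrable lebesgue h"
    and "\<lbrakk>a \<le> s; t \<le> b\<rbrakk> \<Longrightarrow> (LINT r:{s<..<t}|lebesgue. g r) = integral {s..t} h"
proof -
  show h: "integrable lebesgue h"
    using assms by (simp add: set_integrable_def)
  assume st: "a \<le> s" "t \<le> b"
  have "(LINT r:{s<..<t}|lebesgue. g r) = (LINT r:{s<..<t}|lebesgue. h r)"
    using st by (intro set_lebesgue_integral_cong) (auto simp: h_def indicator_def)
  also have "\<dots> = integral {s..t} h"
    using h st by (intro set_lebesgue_integral_Ioo_eq_integral[of a b] set_integrable_of_integrable) auto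
  finally show "(LINT r:{s<..<t}|lebesgue. g r) = integral {s..t} h" .
qed

theorem theorem6p2:
  fixes X :: "'a set" and cost :: "real \<Rightarrow> 'a \<Rightarrow> 'a \<Rightarrow> real"
    and a b :: real and u :: "real \<Rightarrow> 'a"
  assumes "action_space X cost"
    and "a < b"
    and "action_abs_cont X cost a b u"
  shows "(AE t\<in>{a<..<b} in lebesgue.
            ((\<lambda>\<sigma>. cost (\<sigma> - t) (u t) (u \<sigma>) / (\<sigma> - t)) \<longlongrightarrow> action_density cost u t) (at_right t)
          \<and> ((\<lambda>\<sigma>. cost (t - \<sigma>) (u \<sigma>) (u t) / (t - \<sigma>)) \<longlongrightarrow> action_density cost u t) (at_left t))
    \<and> (\<forall>s t. a \<le> s \<and> s < t \<and> t \<le> b \<longrightarrow>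
          cost (t - s) (u s) (u t) \<le> (LINT r:{s<..<t}|lebesgue. action_density cost u r))
    \<and> (\<forall>g. action_majorant cost a b u g \<longrightarrow>
          (AE t\<in>{a<..<b} in lebesgue. action_density cost u t \<le> g t))
    \<and> set_integrable lebesgue {a<..<b} (action_density cost u)"
proof -
  obtain g where u: "u \<in> {a..b} \<rightarrow> X" and g: "set_integrable lebesgue {a<..<b} g"
    and le_g: "\<And>s t. \<lbrakk>a \<le> s; s < t; t \<le> b\<rbrakk> \<Longrightarrow>
      cost (t - s) (u s) (u t) \<le> (LINT r:{s<..<t}|lebesgue. g r)"
    using assms(3) unfolding action_abs_cont_def action_majorant_def by blast
  define A where "A s t = cost (t - s) (u s) (u t)" for s t
  have dom: "dominated_interval_function A a b (\<lambda>x. indicator {a<..<b} x *\<^sub>R g x)"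
  proof
    show "(\<lambda>x. indicator {a<..<b} x *\<^sub>R g x) absolutely_integrable_on {a..b}"
      by (intro set_integrable_of_integrable set_integrable_Ioo_extend(1) g) auto
    show "0 \<le> A s t" if "a \<le> s" "s < t" "t \<le> b" for s t
      unfolding A_def using that u by (intro action_space.cost_nonneg[OF assms(1)]) auto
    show "A s t \<le> A s r + A r t" if "a \<le> s" "s < r" "r < t" "t \<le> b" for s r t
      unfolding A_def using that u action_space.cost_concat[OF assms(1), of "r - s" "t - r" "u s" "u r" "u t"]
      by (auto simp: Pi_iff)
    show "A s t \<le> integral {s..t} (\<lambda>x. indicator {a<..<b} x *\<^sub>R g x)"
      if "a \<le> s" "s < t" "t \<le> b" for s t
      using le_g[OF that] set_integrable_Ioo_extend(2)[OF g, of s t] that by (simp add: A_def)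
  qed fact
  obtain m where m: "integrable lebesgue m"
    and A_le: "\<And>s t. \<lbrakk>a \<le> s; s < t; t \<le> b\<rbrakk> \<Longrightarrow> A s t \<le> integral {s..t} m"
    and right: "AE x\<in>{a<..<b} in lebesgue. ((\<lambda>y. A x y / (y - x)) \<longlongrightarrow> m x) (at_right x)"
    and left: "AE x\<in>{a<..<b} in lebesgue. ((\<lambda>y. A y x / (x - y)) \<longlongrightarrow> m x) (at_left x)"
    by (rule dominated_interval_function.density_exists[OF dom]) (rule that)
  let ?d = "action_density cost u"
  have d_eq: "AE x\<in>{a<..<b} in lebesgue. ?d x = m x"
    using right by eventually_elim (auto simp: action_density_def A_def intro!: tendsto_Lim)
  then obtain N where N: "N \<in> null_sets lebesgue"
    and d_N: "\<And>x. \<lbrakk>x \<in> {a<..<b}; x \<notin> N\<rbrakk> \<Longrightarrow> ?d x = m x"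
    by (auto elim!: AE_E3)
  have d_int: "set_integrable lebesgue {a<..<b} ?d"
  proof (rule absolutely_integrable_spike)
    show "m absolutely_integrable_on {a<..<b}"
      using m by (intro set_integrable_of_integrable) auto
    show "negligible N" using N by (simp add: negligible_iff_null_sets)
  qed (use d_N in auto)
  have limits: "AE t\<in>{a<..<b} in lebesgue.
            ((\<lambda>\<sigma>. cost (\<sigma> - t) (u t) (u \<sigma>) / (\<sigma> - t)) \<longlongrightarrow> ?d t) (at_right t)
          \<and> ((\<lambda>\<sigma>. cost (t - \<sigma>) (u \<sigma>) (u t) / (t - \<sigma>)) \<longlongrightarrow> ?d t) (at_left t)"
    using right left d_eq by eventually_elim (simp add: A_def)
  have d_majorant: "cost (t - s) (u s) (u t) \<le> (LINT r:{s<..<t}|lebesgue. ?d r)"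
    if "a \<le> s" "s < t" "t \<le> b" for s t
  proof -
    have "integral {s..t} m = integral {s..t} ?d"
    proof (rule integral_spike)
      show "negligible (N \<union> {a, b})" using N by (simp add: negligible_iff_null_sets null_sets.Un)
      show "?d x = m x" if "x \<in> {s..t} - (N \<union> {a, b})" for x
        using that \<open>a \<le> s\<close> \<open>t \<le> b\<close> by (intro d_N) auto
    qed
    also have "\<dots> = (LINT r:{s<..<t}|lebesgue. ?d r)"
      using that by (intro set_lebesgue_integral_Ioo_eq_integral[symmetric, OF d_int]) auto
    finally show ?thesis using A_le[OF that] by (simp add: A_def)
  qed
  \<comment> \<open>A majorant bounds the quotients of the cost by its own averages; letting the interval shrink
      compares the two limits.\<close>
  have d_least: "AE t\<in>{a<..<b} in lebesgue. ?d t \<le> f t" if f: "action_majorant cost a b u f" for f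
  proof -
    define h where "h x = indicator {a<..<b} x *\<^sub>R f x" for x
    have f_int: "set_integrable lebesgue {a<..<b} f"
      and le_f: "\<And>s t. \<lbrakk>a \<le> s; s < t; t \<le> b\<rbrakk> \<Longrightarrow> A s t \<le> (LINT r:{s<..<t}|lebesgue. f r)"
      using f by (auto simp: action_majorant_def A_def)
    have le_h: "A s t \<le> integral {s..t} h" if "a \<le> s" "s < t" "t \<le> b" for s t
      using le_f[OF that] set_integrable_Ioo_extend(2)[OF f_int, of s t] that by (simp add: h_def[abs_def])
    have "h integrable_on {s..t}" for s t
      using integrable_on_lebesgue[OF set_integrable_Ioo_extend(1)[OF f_int]]
      unfolding h_def[abs_def] by (rule integrable_on_subinterval) auto
    from right_average_tendsto_AE[OF this] right d_eq
    show ?thesis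
    proof eventually_elim
      case (elim x)
      show ?case
      proof
        assume x: "x \<in> {a<..<b}"
        have "\<forall>\<^sub>F y in at_right x. A x y / (y - x) \<le> integral {x..y} h / (y - x)"
          unfolding eventually_at_right_field using x le_h[of x]
          by (intro exI[of _ b]) (auto intro!: divide_right_mono)
        then have "m x \<le> h x"
          using elim x by (intro tendsto_le[of "at_right x"]) auto
        then show "?d x \<le> f x" using elim x by (simp add: h_def)
      qed
    qed
  qed
  show ?thesis
    using limits d_majorant d_least d_int by blast
qed

end
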